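(* Let $k_1,k_2\ge1$ be integers. For all $n\ge k_1+k_2$, $$P_{q,\theta}(\widehat W_L=n)=\widehat P^{(1)}_{q,L}(n)+\widehat P^{(0)}_{q,L}(n),$$ where $$\widehat P^{(1)}_{q,L}(n)=\theta^{k_1}\prod_{j=1}^{n-k_1}(1-\theta q^{j-1})\sum_{s=1}^{k_1}\Big[I_{q,0,k_2}(k_1,n-k_1,s)+J_{q,0,k_2}(k_1,n-k_1,s)\Big]$$ and $$\widehat P^{(0)}_{q,L}(n)=\sum_{i=k_1}^{n-k_2}\theta^{i}\prod_{j=1}^{n-i}(1-\theta q^{j-1})\sum_{s=k_1}^{i}\Big[\overline G_{q,0,0}^{\infty,k_2}(i,n-k_2-i,s)+\overline H_{q,0,0}^{\infty,k_2}(i,n-k_2-i,s)\Big].$$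
   Context: Model: fix reals $0\le\theta\le1$ and $0<q<1$. $(X_j)_{j\ge1}$ is a sequence of $\{0,1\}$-valued random variables (1 = success, 0 = failure) with law $P_{q,\theta}$ such that, conditionally on $X_1,\dots,X_{j-1}$ containing exactly $i-1$ zeros, $X_j=0$ with probability $1-\theta q^{i-1}$ and $X_j=1$ with probability $\theta q^{i-1}$. Conventions: $0^0=1$, empty products are 1, empty sums are 0. Waiting times: $N_1$ is the trial at which the $k_1$-th success (in total) occurs; $T_0$ is the least $n\ge k_2$ with $X_{n-k_2+1}=\dots=X_n=0$ (each is $\infty$ if it does not occur). $\widehat W_L=\max(N_1,T_0)$ (frequency quota on successes, run quota on failures, later case); $\widehat P^{(1)}_{q,L}(n)=P_{q,\theta}(N_1=n,\ T_0<n)$ and $\widehat P^{(0)}_{q,L}(n)=P_{q,\theta}(T_0=n,\ N_1<n)$. For $s\ge1$, $S_{r,s}^{k}$ denotes the set of $s$-tuples of positive integers with sum $r$ and maximum $>k$ (for $k=0$ the maximum condition is vacuous). For $s=0$, $S_{0,0}^0$ consists of the single empty tuple and every other $S_{r,0}^k$ is empty. Combinatorial sums, for integers $m,r$ and $s\ge1$: - $I_{q,0,k_2}(m,r,s)=\sum q^{\sum_{j=2}^{s}(y_1+\dots+y_{j-1})x_j}$ over $(x_1,\dots,x_s)\in S_{m,s}^0$, $(y_1,\dots,y_{s-1})\in S_{r,s-1}^{k_2-1}$; - $J_{q,0,k_2}(m,r,s)=\sum q^{\sum_{j=1}^{s}(y_1+\dots+y_j)x_j}$ over $(x_1,\dots,x_s)\in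 S_{m,s}^0$, $(y_1,\dots,y_s)\in S_{r,s}^{k_2-1}$; - $\overline G_{q,0,0}^{\infty,k_2}(m,r,s)=\sum q^{\sum_{j=2}^{s}(y_1+\dots+y_{j-1})x_j}$ over $(x_1,\dots,x_s)\in S_{m,s}^0$ and $(y_1,\dots,y_{s-1})\in S_{r,s-1}^0$ with all $y_j<k_2$; - $\overline H_{q,0,0}^{\infty,k_2}(m,r,s)=\sum q^{\sum_{j=1}^{s}(y_1+\dots+y_j)x_j}$ over $(x_1,\dots,x_s)\in S_{m,s}^0$ and $(y_1,\dots,y_s)\in S_{r,s}^0$ with all $y_j<k_2$.
   Formalization: In the formula for P^(0)_{q,L}(n) the inner sum is taken over s from 1 to i instead of from k_1 to i; as printed it is false for k_1≥2 and 0<θ<1 (e.g. k_1=k_2=2, n=4, θ=q=1/2 gives 0 instead of 3/32). *)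

theory Defs
  imports "HOL-Probability.Probability" "HOL-Library.Extended_Nat"
begin

section \<open>The sequence of trials\<close>

text \<open>
  Trials are numbered from 1; \<open>X 0\<close> plays no role. The law \<open>P\<^bsub>q,\<theta>\<^esub>\<close> is specified by
  conditioning on each full history \<open>x 1, \<dots>, x (j - 1)\<close> of positive probability: if that
  history has exactly \<open>m\<close> zeros (\<open>m = i - 1\<close> in the usual notation) then trial \<open>j\<close> is a
  success with probability \<open>\<theta> q\<^sup>m\<close>. Conditioning on the number of zeros alone would not
  determine the law of the sequence.
\<close>

definition q_trials :: "real \<Rightarrow> real \<Rightarrow> 'a measure \<Rightarrow> (nat \<Rightarrow> 'a \<Rightarrow> nat) \<Rightarrow> bool" where
  "q_trials q \<theta> M X \<longleftrightarrow>
     prob_space M \<and>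
     (\<forall>j\<ge>1. X j \<in> measurable M (count_space UNIV)) \<and>
     (\<forall>j\<ge>1. \<forall>\<omega>\<in>space M. X j \<omega> \<in> {0, 1}) \<and>
     (\<forall>j\<ge>1. \<forall>x :: nat \<Rightarrow> nat.
        \<P>(\<omega> in M. \<forall>i\<in>{1..<j}. X i \<omega> = x i) > 0 \<longrightarrow>
        \<P>(\<omega> in M. X j \<omega> = 0 \<bar> \<forall>i\<in>{1..<j}. X i \<omega> = x i)
          = 1 - \<theta> * q ^ card {i\<in>{1..<j}. x i = 0} \<and>
        \<P>(\<omega> in M. X j \<omega> = 1 \<bar> \<forall>i\<in>{1..<j}. X i \<omega> = x i)
          = \<theta> * q ^ card {i\<in>{1..<j}. x i = 0})"

text \<open>
  Waiting times take the value \<open>\<infinity>\<close> when the event never occurs, since the infimum of the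
  empty set in \<^typ>\<open>enat\<close> is \<open>\<infinity>\<close>.
\<close>

definition success_quota_time :: "nat \<Rightarrow> (nat \<Rightarrow> 'a \<Rightarrow> nat) \<Rightarrow> 'a \<Rightarrow> enat" where
  "success_quota_time k X \<omega> =
     (INF n\<in>{n. 1 \<le> n \<and> X n \<omega> = 1 \<and> card {j\<in>{1..n}. X j \<omega> = 1} = k}. enat n)"

definition failure_run_time :: "nat \<Rightarrow> (nat \<Rightarrow> 'a \<Rightarrow> nat) \<Rightarrow> 'a \<Rightarrow> enat" where
  "failure_run_time k X \<omega> =
     (INF n\<in>{n. k \<le> n \<and> (\<forall>j\<in>{n - k + 1..n}. X j \<omega> = 0)}. enat n)"

definition W_L :: "nat \<Rightarrow> nat \<Rightarrow> (nat \<Rightarrow> 'a \<Rightarrow> nat) \<Rightarrow> 'a \<Rightarrow> enat" where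
  "W_L k1 k2 X \<omega> = max (success_quota_time k1 X \<omega>) (failure_run_time k2 X \<omega>)"

definition P1_L :: "'a measure \<Rightarrow> (nat \<Rightarrow> 'a \<Rightarrow> nat) \<Rightarrow> nat \<Rightarrow> nat \<Rightarrow> nat \<Rightarrow> real" where
  "P1_L M X k1 k2 n =
     \<P>(\<omega> in M. success_quota_time k1 X \<omega> = enat n \<and> failure_run_time k2 X \<omega> < enat n)"

definition P0_L :: "'a measure \<Rightarrow> (nat \<Rightarrow> 'a \<Rightarrow> nat) \<Rightarrow> nat \<Rightarrow> nat \<Rightarrow> nat \<Rightarrow> real" where
  "P0_L M X k1 k2 n =
     \<P>(\<omega> in M. failure_run_time k2 X \<omega> = enat n \<and> success_quota_time k1 X \<omega> < enat n)"

section \<open>Combinatorial sums\<close>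

text \<open>
  Tuples are lists, so \<open>x\<^sub>j\<close> is \<open>xs ! (j - 1)\<close> and \<open>y\<^sub>1 + \<dots> + y\<^sub>j\<close> is
  \<open>sum_list (take j ys)\<close>. For the empty tuple the maximum condition is read as \<open>k = 0\<close>.
\<close>

definition S_tuples :: "nat \<Rightarrow> nat \<Rightarrow> nat \<Rightarrow> nat list set" where
  "S_tuples k r s =
     {xs. length xs = s \<and> (\<forall>x\<in>set xs. 0 < x) \<and> sum_list xs = r \<and>
          (if s = 0 then k = 0 else k < Max (set xs))}"

definition I_sum :: "real \<Rightarrow> nat \<Rightarrow> nat \<Rightarrow> nat \<Rightarrow> nat \<Rightarrow> real" where
  "I_sum q k2 m r s =
     (\<Sum>(xs, ys)\<in>S_tuples 0 m s \<times> S_tuples (k2 - 1) r (s - 1).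
        q ^ (\<Sum>j=2..s. sum_list (take (j - 1) ys) * xs ! (j - 1)))"

definition J_sum :: "real \<Rightarrow> nat \<Rightarrow> nat \<Rightarrow> nat \<Rightarrow> nat \<Rightarrow> real" where
  "J_sum q k2 m r s =
     (\<Sum>(xs, ys)\<in>S_tuples 0 m s \<times> S_tuples (k2 - 1) r s.
        q ^ (\<Sum>j=1..s. sum_list (take j ys) * xs ! (j - 1)))"

definition G_bar :: "real \<Rightarrow> nat \<Rightarrow> nat \<Rightarrow> nat \<Rightarrow> nat \<Rightarrow> real" where
  "G_bar q k2 m r s =
     (\<Sum>(xs, ys)\<in>S_tuples 0 m s \<times> {ys \<in> S_tuples 0 r (s - 1). \<forall>y\<in>set ys. y < k2}.
        q ^ (\<Sum>j=2..s. sum_list (take (j - 1) ys) * xs ! (j - 1)))"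

definition H_bar :: "real \<Rightarrow> nat \<Rightarrow> nat \<Rightarrow> nat \<Rightarrow> nat \<Rightarrow> real" where
  "H_bar q k2 m r s =
     (\<Sum>(xs, ys)\<in>S_tuples 0 m s \<times> {ys \<in> S_tuples 0 r s. \<forall>y\<in>set ys. y < k2}.
        q ^ (\<Sum>j=1..s. sum_list (take j ys) * xs ! (j - 1)))"

text \<open>
  In the formula for \<^const>\<open>P0_L\<close> the number \<open>s\<close> of success runs ranges over \<open>1, \<dots>, i\<close>,
  where \<open>i\<close> is the number of successes. The published formula starts this sum at \<open>s = k1\<close>,
  which omits outcomes and is false whenever \<open>k1 \<ge> 2\<close> and \<open>0 < \<theta> < 1\<close>: at
  \<open>n = k1 + k2\<close> it leaves out \<open>k1\<close> successes (a single run) followed by \<open>k2\<close> failures.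
\<close>

lemma finite_S_tuples: "finite (S_tuples k r s)"
proof (rule finite_subset)
  show "S_tuples k r s \<subseteq> {xs. set xs \<subseteq> {..r} \<and> length xs = s}"
    by (auto simp: S_tuples_def dest: member_le_sum_list)
  show "finite {xs. set xs \<subseteq> {..r} \<and> length xs = s}"
    by (rule finite_lists_length_eq) simp
qed

end

theory Submission
  imports Defs "HOL-Library.Sublist"
begin

text \<open>
  Everything in sight is decided by the word of the first \<open>n\<close> outcomes, and the law of that word
  is explicit. A failure preceded by \<open>j - 1\<close> failures contributes \<open>1 - \<theta> q\<^sup>j\<^sup>-\<^sup>1\<close>, so the failures
  together contribute a product that depends only on their number. A success preceded by \<open>m\<close>
  failures contributes \<open>\<theta> q\<^sup>m\<close>, so the successes contribute a power of \<open>\<theta>\<close> times \<open>q\<close> to the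
  number of pairs (failure, later success). Only this last exponent depends on the arrangement
  (\<open>prob_outcomes_eq\<close>), and the probability of an event about the word is a sum of such weights.

  The two waiting times cannot both equal \<open>n\<close>, since one requires a success and the other a
  failure at trial \<open>n\<close>; hence the event splits into two. The quota is reached last at \<open>n\<close>
  exactly when the word ends in a success, has \<open>k1\<close> successes, and contains a run of \<open>k2\<close>
  failures (\<open>quota_last_iff\<close>). The run is completed last at \<open>n\<close> exactly when the word is a word
  that ends in a success, has no such run and at least \<open>k1\<close> successes, followed by exactly \<open>k2\<close>
  failures (\<open>run_last_iff\<close>). The trailing failures precede no success, so they leave the
  exponent of \<open>q\<close> alone.

  Both cases therefore ask for the sum of \<open>q\<close> to the number of pairs over words that end in a
  success. Such a word is an alternation of runs of failures and successes, so it is the same as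
  the list \<open>ys\<close> of its failure run lengths together with the list \<open>xs\<close> of its success run lengths
  (\<open>bij_betw_word_of_runs\<close>). The successes of the \<open>j\<close>-th run all have \<open>y\<^sub>1 + \<dots> + y\<^sub>j\<close> failures
  before them, which turns the number of pairs into the exponents of the combinatorial sums; and
  there is a run of \<open>k2\<close> failures iff some \<open>y\<^sub>j\<close> is at least \<open>k2\<close>. Words that start with a
  success give the sums \<open>I\<close> and \<open>G\<close>, words that start with a failure give \<open>J\<close> and \<open>H\<close>.
\<close>

section \<open>Words of trials and their probabilities\<close>

definition outcomes :: "(nat \<Rightarrow> 'a \<Rightarrow> nat) \<Rightarrow> nat \<Rightarrow> 'a \<Rightarrow> bool list" where
  "outcomes X n \<omega> = map (\<lambda>j. X j \<omega> = 1) [1..<Suc n]"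

lemma length_outcomes [simp]: "length (outcomes X n \<omega>) = n"
  by (simp add: outcomes_def)

lemma outcomes_0 [simp]: "outcomes X 0 \<omega> = []"
  by (simp add: outcomes_def)

lemma outcomes_Suc: "outcomes X (Suc n) \<omega> = outcomes X n \<omega> @ [X (Suc n) \<omega> = 1]"
  by (simp add: outcomes_def)

text \<open>
  The number of pairs of positions carrying a failure and a later success. Counting pairs,
  rather than adding up for each success the failures before it, makes the behaviour under
  concatenation symmetric and keeps the recursion free of an accumulator.
\<close>

fun failure_success_pairs :: "bool list \<Rightarrow> nat" where
  "failure_success_pairs [] = 0"
| "failure_success_pairs (b # bs) =
     (if b then 0 else count_list bs True) + failure_success_pairs bs"

lemma failure_success_pairs_append:
  "failure_success_pairs (as @ bs) =
     failure_success_pairs as + count_list as False * count_list bs True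
       + failure_success_pairs bs"
  by (induction as) (auto simp: algebra_simps)

lemma failure_success_pairs_replicate [simp]: "failure_success_pairs (replicate n b) = 0"
  by (induction n) (auto simp: count_list_0_iff)

lemma count_list_replicate: "count_list (replicate n a) b = (if a = b then n else 0)"
  by (induction n) auto

lemma count_True_plus_count_False: "count_list bs True + count_list bs False = length bs"
  by (induction bs) auto

definition word_weight :: "real \<Rightarrow> real \<Rightarrow> bool list \<Rightarrow> real" where
  "word_weight q \<theta> bs =
     \<theta> ^ count_list bs True * (\<Prod>j=1..count_list bs False. 1 - \<theta> * q ^ (j - 1))
       * q ^ failure_success_pairs bs"

lemma word_weight_snoc:
  "word_weight q \<theta> (bs @ [b]) = word_weight q \<theta> bs *
     (if b then \<theta> * q ^ count_list bs False else 1 - \<theta> * q ^ count_list bs False)"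
  by (auto simp: word_weight_def failure_success_pairs_append power_add algebra_simps)

text \<open>
  Translates the number of zeros of a history, in the form in which the law of the trials
  mentions it, to words. Trial \<open>i\<close> is entry \<open>i - 1\<close> of the word.
\<close>

lemma card_failures_eq_count_list:
  "card {i\<in>{1..<Suc (length bs)}. (if bs ! (i - 1) then 1 else 0 :: nat) = 0} = count_list bs False"
proof (induction bs rule: rev_induct)
  case (snoc b bs)
  have "{i\<in>{1..<Suc (length (bs @ [b]))}. (if (bs @ [b]) ! (i - 1) then 1 else 0 :: nat) = 0} =
      {i\<in>{1..<Suc (length bs)}. (if bs ! (i - 1) then 1 else 0 :: nat) = 0} \<union>
      (if b then {} else {Suc (length bs)})"
    by (auto simp: nth_append split: if_splits)
  then show ?case using snoc by auto
qed simp

lemma outcomes_eq_iff: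
  assumes "\<forall>j\<ge>1. X j \<omega> \<in> {0, 1}" "length bs = n"
  shows "outcomes X n \<omega> = bs \<longleftrightarrow> (\<forall>i\<in>{1..<Suc n}. X i \<omega> = (if bs ! (i - 1) then 1 else 0))"
  using assms(2)
proof (induction n arbitrary: bs)
  case (Suc n)
  then obtain b cs where bs: "bs = cs @ [b]" "length cs = n"
    by (metis length_Suc_conv_rev)
  have "outcomes X (Suc n) \<omega> = bs \<longleftrightarrow> outcomes X n \<omega> = cs \<and> (X (Suc n) \<omega> = 1) = b"
    by (simp add: outcomes_Suc bs(1))
  also have "\<dots> \<longleftrightarrow> (\<forall>i\<in>{1..<Suc n}. X i \<omega> = (if cs ! (i - 1) then 1 else 0)) \<and> (X (Suc n) \<omega> = 1) = b"
    by (simp only: Suc.IH[OF bs(2)])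
  also have "\<dots> \<longleftrightarrow> (\<forall>i\<in>{1..<Suc n}. X i \<omega> = (if bs ! (i - 1) then 1 else 0)) \<and>
      X (Suc n) \<omega> = (if bs ! (Suc n - 1) then 1 else 0)"
    using assms(1)[rule_format, of "Suc n"] bs by (intro conj_cong ball_cong refl) (auto simp: nth_append)
  also have "\<dots> \<longleftrightarrow> (\<forall>i\<in>insert (Suc n) {1..<Suc n}. X i \<omega> = (if bs ! (i - 1) then 1 else 0))"
    by blast
  also have "insert (Suc n) {1..<Suc n} = {1..<Suc (Suc n)}" by auto
  finally show ?case .
qed simp

lemma measurable_outcomes:
  assumes "q_trials q \<theta> M X"
  shows "outcomes X n \<in> measurable M (count_space UNIV)"
proof (induction n)
  case (Suc n)
  have [measurable]: "X (Suc n) \<in> measurable M (count_space UNIV)"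
    using assms by (auto simp: q_trials_def)
  note Suc [measurable]
  have "(\<lambda>\<omega>. outcomes X n \<omega> @ [X (Suc n) \<omega> = 1]) \<in> measurable M (count_space UNIV)"
    by measurable
  then show ?case by (simp add: outcomes_Suc[abs_def])
qed simp

text \<open>
  The chain rule of conditional probability, one trial at a time. The law of the trials gives no
  conditional probability after a history of probability zero, but there the weight of the
  history, and with it that of every extension, vanishes.
\<close>

lemma prob_outcomes_eq:
  assumes trials: "q_trials q \<theta> M X" and "length bs = n"
  shows "\<P>(\<omega> in M. outcomes X n \<omega> = bs) = word_weight q \<theta> bs"
  using assms(2)
proof (induction n arbitrary: bs)
  case 0
  interpret prob_space M using trials by (simp add: q_trials_def)
  show ?case using 0 by (simp add: word_weight_def prob_space)
next
  case (Suc n)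
  interpret prob_space M using trials by (simp add: q_trials_def)
  note [measurable] = measurable_outcomes[OF trials]
  obtain b cs where bs: "bs = cs @ [b]" "length cs = n"
    using Suc.prems by (metis length_Suc_conv_rev)
  let ?x = "\<lambda>i. if cs ! (i - 1) then 1 else 0 :: nat"
  let ?v = "if b then 1 else 0 :: nat"
  have binary: "\<forall>j\<ge>1. X j \<omega> \<in> {0, 1}" if "\<omega> \<in> space M" for \<omega>
    using trials that unfolding q_trials_def by blast
  have history: "outcomes X n \<omega> = cs \<longleftrightarrow> (\<forall>i\<in>{1..<Suc n}. X i \<omega> = ?x i)" if "\<omega> \<in> space M" for \<omega>
    using outcomes_eq_iff[of X \<omega> cs n] binary[OF that] bs by simp
  have history_prob: "\<P>(\<omega> in M. \<forall>i\<in>{1..<Suc n}. X i \<omega> = ?x i) = word_weight q \<theta> cs"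
  proof -
    have "{\<omega>\<in>space M. \<forall>i\<in>{1..<Suc n}. X i \<omega> = ?x i} = {\<omega>\<in>space M. outcomes X n \<omega> = cs}"
      by (intro Collect_cong conj_cong refl) (rule history[symmetric])
    then show ?thesis by (simp only: Suc.IH[OF bs(2)])
  qed
  have split: "outcomes X (Suc n) \<omega> = bs \<longleftrightarrow> X (Suc n) \<omega> = ?v \<and> (\<forall>i\<in>{1..<Suc n}. X i \<omega> = ?x i)"
    if "\<omega> \<in> space M" for \<omega>
  proof -
    have "outcomes X (Suc n) \<omega> = bs \<longleftrightarrow> (X (Suc n) \<omega> = 1) = b \<and> outcomes X n \<omega> = cs"
      by (auto simp: outcomes_Suc bs(1))
    moreover have "(X (Suc n) \<omega> = 1) = b \<longleftrightarrow> X (Suc n) \<omega> = ?v"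
      using binary[OF that, rule_format, of "Suc n"] by auto
    ultimately show ?thesis by (simp only: history[OF that])
  qed
  have joint: "\<P>(\<omega> in M. outcomes X (Suc n) \<omega> = bs) =
      \<P>(\<omega> in M. X (Suc n) \<omega> = ?v \<and> (\<forall>i\<in>{1..<Suc n}. X i \<omega> = ?x i))"
    by (intro arg_cong[where f = "measure M"] Collect_cong conj_cong refl) (rule split)
  show ?case
  proof (cases "word_weight q \<theta> cs = 0")
    case True
    have "\<P>(\<omega> in M. outcomes X (Suc n) \<omega> = bs) \<le> \<P>(\<omega> in M. outcomes X n \<omega> = cs)"
      by (rule finite_measure_mono) (auto simp: outcomes_Suc bs)
    then have "\<P>(\<omega> in M. outcomes X (Suc n) \<omega> = bs) = 0"
      unfolding Suc.IH[OF bs(2)] True measure_le_0_iff .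
    then show ?thesis using True by (simp add: bs word_weight_snoc)
  next
    case False
    then have pos: "\<P>(\<omega> in M. \<forall>i\<in>{1..<Suc n}. X i \<omega> = ?x i) > 0"
      by (simp only: history_prob[symmetric] zero_less_measure_iff not_False_eq_True)
    have mult_eq_if_div_eq: "a = w * c" if "a / w = c" "w \<noteq> 0" for a w c :: real
      using that by auto
    have cond: "\<P>(\<omega> in M. X (Suc n) \<omega> = ?v \<bar> \<forall>i\<in>{1..<Suc n}. X i \<omega> = ?x i) =
        (if b then \<theta> * q ^ count_list cs False else 1 - \<theta> * q ^ count_list cs False)"
    proof -
      have "Suc n \<ge> 1" by simp
      note step = trials[unfolded q_trials_def, THEN conjunct2, THEN conjunct2, THEN conjunct2,
          THEN spec[of _ "Suc n"], THEN mp, OF this, THEN spec[of _ ?x], THEN mp, OF pos,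
          unfolded card_failures_eq_count_list[of cs, unfolded bs(2)]]
      show ?thesis
      proof (cases b)
        case True
        then show ?thesis using step[THEN conjunct2] by (simp only: if_True)
      next
        case False
        then show ?thesis using step[THEN conjunct1] by (simp only: if_False)
      qed
    qed
    have "\<P>(\<omega> in M. X (Suc n) \<omega> = ?v \<and> (\<forall>i\<in>{1..<Suc n}. X i \<omega> = ?x i)) =
        word_weight q \<theta> cs *
        (if b then \<theta> * q ^ count_list cs False else 1 - \<theta> * q ^ count_list cs False)"
      by (rule mult_eq_if_div_eq[OF cond[unfolded cond_prob_def history_prob] False])
    then show ?thesis
      unfolding joint unfolding bs(1) word_weight_snoc .
  qed
qed

lemma prob_outcomes_mem:
  assumes trials: "q_trials q \<theta> M X" and "B \<subseteq> {bs. length bs = n}"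
  shows "\<P>(\<omega> in M. outcomes X n \<omega> \<in> B) = (\<Sum>bs\<in>B. word_weight q \<theta> bs)"
proof -
  interpret prob_space M using trials by (simp add: q_trials_def)
  note [measurable] = measurable_outcomes[OF trials]
  have fin: "finite B"
    by (rule finite_subset[OF assms(2)]) (use finite_lists_length_eq[of "UNIV :: bool set" n] in simp)
  have "\<P>(\<omega> in M. outcomes X n \<omega> \<in> B) = measure M (\<Union>bs\<in>B. {\<omega>\<in>space M. outcomes X n \<omega> = bs})"
    by (rule arg_cong[where f = "measure M"]) auto
  also have "\<dots> = (\<Sum>bs\<in>B. \<P>(\<omega> in M. outcomes X n \<omega> = bs))"
    by (rule finite_measure_finite_Union) (auto simp: fin disjoint_family_on_def)
  also have "\<dots> = (\<Sum>bs\<in>B. word_weight q \<theta> bs)"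
    using prob_outcomes_eq[OF trials] assms(2) by (intro sum.cong) auto
  finally show ?thesis .
qed

section \<open>Waiting times as conditions on words\<close>

abbreviation has_failure_run :: "nat \<Rightarrow> bool list \<Rightarrow> bool" where
  "has_failure_run k bs \<equiv> sublist (replicate k False) bs"

lemma card_successes_eq_count_list:
  "card {j\<in>{1..n}. X j \<omega> = 1} = count_list (outcomes X n \<omega>) True"
proof (induction n)
  case (Suc n)
  have "{j\<in>{1..Suc n}. X j \<omega> = 1} =
      {j\<in>{1..n}. X j \<omega> = 1} \<union> (if X (Suc n) \<omega> = 1 then {Suc n} else {})"
    by (auto simp: le_Suc_eq)
  then show ?case using Suc by (auto simp: outcomes_Suc)
qed simp

text \<open>
  The count of successes grows in unit steps, so once it has reached \<open>k\<close> there was a trial at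
  which it became equal to \<open>k\<close>.
\<close>

lemma success_quota_time_less_iff:
  assumes "k \<ge> 1"
  shows "success_quota_time k X \<omega> < enat (Suc n) \<longleftrightarrow> k \<le> count_list (outcomes X n \<omega>) True"
proof -
  have "success_quota_time k X \<omega> < enat (Suc n) \<longleftrightarrow>
      (\<exists>m\<in>{1..n}. X m \<omega> = 1 \<and> count_list (outcomes X m \<omega>) True = k)"
    unfolding success_quota_time_def card_successes_eq_count_list
    by (auto simp: INF_less_iff less_Suc_eq_le)
  also have "\<dots> \<longleftrightarrow> k \<le> count_list (outcomes X n \<omega>) True"
  proof (induction n)
    case 0
    then show ?case using assms by simp
  next
    case (Suc n)
    have "(\<exists>m\<in>{1..Suc n}. X m \<omega> = 1 \<and> count_list (outcomes X m \<omega>) True = k) \<longleftrightarrow>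
        k \<le> count_list (outcomes X n \<omega>) True \<or>
        (X (Suc n) \<omega> = 1 \<and> count_list (outcomes X (Suc n) \<omega>) True = k)"
      using Suc by (simp add: atLeastAtMostSuc_conv disj_commute)
    then show ?case by (auto simp: outcomes_Suc)
  qed
  finally show ?thesis .
qed

lemma success_quota_time_eq_iff:
  assumes "k \<ge> 1"
  shows "success_quota_time k X \<omega> = enat (Suc n) \<longleftrightarrow>
    X (Suc n) \<omega> = 1 \<and> count_list (outcomes X (Suc n) \<omega>) True = k"
proof -
  have "success_quota_time k X \<omega> = enat (Suc n) \<longleftrightarrow>
     success_quota_time k X \<omega> < enat (Suc (Suc n)) \<and> \<not> success_quota_time k X \<omega> < enat (Suc n)"
    by (cases "success_quota_time k X \<omega>") auto
  then show ?thesis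
    using assms by (auto simp: success_quota_time_less_iff outcomes_Suc)
qed

lemma replicate_Suc_snoc: "replicate (Suc k) a = replicate k a @ [a]"
  by (simp add: replicate_append_same)

lemma suffix_failures_outcomes_iff:
  "suffix (replicate k False) (outcomes X n \<omega>) \<longleftrightarrow> k \<le> n \<and> (\<forall>j\<in>{n - k + 1..n}. X j \<omega> \<noteq> 1)"
proof (induction k arbitrary: n)
  case (Suc k)
  show ?case
  proof (cases n)
    case [simp]: (Suc m)
    have "suffix (replicate (Suc k) False) (outcomes X n \<omega>) \<longleftrightarrow>
        X (Suc m) \<omega> \<noteq> 1 \<and> suffix (replicate k False) (outcomes X m \<omega>)"
      by (auto simp: outcomes_Suc replicate_Suc_snoc simp del: replicate.simps)
    also have "\<dots> \<longleftrightarrow> X (Suc m) \<omega> \<noteq> 1 \<and> k \<le> m \<and> (\<forall>j\<in>{m - k + 1..m}. X j \<omega> \<noteq> 1)"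
      using Suc.IH by simp
    also have "\<dots> \<longleftrightarrow> Suc k \<le> n \<and> (\<forall>j\<in>{n - Suc k + 1..n}. X j \<omega> \<noteq> 1)"
      by (auto simp: atLeastAtMostSuc_conv)
    finally show ?thesis .
  qed auto
qed simp

text \<open>
  A word contains the run as a factor iff one of its prefixes ends with it, that is, iff the run
  has been completed at some trial up to \<open>n\<close>.
\<close>

lemma failure_run_time_less_iff:
  assumes "\<forall>j\<ge>1. X j \<omega> \<in> {0, 1}"
  shows "failure_run_time k X \<omega> < enat (Suc n) \<longleftrightarrow> has_failure_run k (outcomes X n \<omega>)"
proof -
  have eq: "k \<le> m \<and> (\<forall>j\<in>{m - k + 1..m}. X j \<omega> = 0) \<longleftrightarrow> suffix (replicate k False) (outcomes X m \<omega>)"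
    for m unfolding suffix_failures_outcomes_iff
  proof (intro conj_cong ball_cong refl)
    fix j assume "j \<in> {m - k + 1..m}"
    then have "X j \<omega> \<in> {0, 1}" using assms(1) by simp
    then show "X j \<omega> = 0 \<longleftrightarrow> X j \<omega> \<noteq> 1" by auto
  qed
  have "failure_run_time k X \<omega> < enat (Suc n) \<longleftrightarrow>
      (\<exists>m\<le>n. suffix (replicate k False) (outcomes X m \<omega>))"
    unfolding failure_run_time_def eq by (auto simp: INF_less_iff less_Suc_eq_le)
  also have "\<dots> \<longleftrightarrow> has_failure_run k (outcomes X n \<omega>)"
  proof (induction n)
    case 0
    then show ?case by simp
  next
    case (Suc n)
    have "(\<exists>m\<le>Suc n. suffix (replicate k False) (outcomes X m \<omega>)) \<longleftrightarrow>
       has_failure_run k (outcomes X n \<omega>) \<or> suffix (replicate k False) (outcomes X (Suc n) \<omega>)"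
      using Suc by (auto simp: le_Suc_eq)
    then show ?case by (auto simp: outcomes_Suc sublist_snoc)
  qed
  finally show ?thesis .
qed

lemma failure_run_time_eq_iff:
  assumes "\<forall>j\<ge>1. X j \<omega> \<in> {0, 1}"
  shows "failure_run_time k X \<omega> = enat (Suc n) \<longleftrightarrow>
    has_failure_run k (outcomes X (Suc n) \<omega>) \<and> \<not> has_failure_run k (outcomes X n \<omega>)"
proof -
  have "failure_run_time k X \<omega> = enat (Suc n) \<longleftrightarrow>
     failure_run_time k X \<omega> < enat (Suc (Suc n)) \<and> \<not> failure_run_time k X \<omega> < enat (Suc n)"
    by (cases "failure_run_time k X \<omega>") auto
  then show ?thesis by (simp only: failure_run_time_less_iff[where X = X and \<omega> = \<omega>, OF assms])
qed

text \<open>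
  A factor that consists of failures lies entirely on one side of a success.
\<close>

lemma has_failure_run_append_success:
  assumes "k \<ge> 1"
  shows "has_failure_run k (as @ True # bs) \<longleftrightarrow> has_failure_run k as \<or> has_failure_run k bs"
proof (induction as)
  case Nil
  show ?case using assms by (cases k) (auto simp: sublist_Cons_right)
next
  case (Cons a as)
  have "prefix (replicate k False) (a # as @ True # bs) \<longleftrightarrow> prefix (replicate k False) (a # as)"
  proof -
    have "prefix (replicate j False) (cs @ True # bs) \<longleftrightarrow> prefix (replicate j False) cs" for j cs
    proof (induction cs arbitrary: j)
      case Nil
      show ?case by (cases j) auto
    next
      case (Cons c cs)
      show ?case using Cons by (cases j) auto
    qed
    from this[of k "a # as"] show ?thesis by simp
  qed
  then show ?case using Cons by (auto simp: sublist_Cons_right)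
qed

lemma has_failure_run_snoc_success:
  assumes "k \<ge> 1"
  shows "has_failure_run k (as @ [True]) \<longleftrightarrow> has_failure_run k as"
  using has_failure_run_append_success[OF assms, of as "[]"] assms by auto

lemma has_failure_run_replicate:
  "has_failure_run k (replicate m False) \<longleftrightarrow> k \<le> m"
proof
  show "has_failure_run k (replicate m False) \<Longrightarrow> k \<le> m"
    using sublist_length_le by fastforce
  assume "k \<le> m"
  then have "replicate m False = replicate k False @ replicate (m - k) False"
    by (simp flip: replicate_add)
  then show "has_failure_run k (replicate m False)" by auto
qed

text \<open>
  If the first run of \<open>k\<close> failures is completed by the last letter, the letter just before that
  run must be a success: a failure there would complete a run one step earlier. A success in the
  word guarantees that such a letter exists.
\<close>

lemma first_failure_run_at_end_iff:
  assumes "k \<ge> 1" "\<exists>b\<in>set bs. b"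
  shows "has_failure_run k bs \<and> \<not> has_failure_run k (butlast bs) \<longleftrightarrow>
    (\<exists>cs. bs = cs @ replicate k False \<and> cs \<noteq> [] \<and> last cs \<and> \<not> has_failure_run k cs)"
proof
  assume L: "has_failure_run k bs \<and> \<not> has_failure_run k (butlast bs)"
  have "bs \<noteq> []" using assms by auto
  then have "has_failure_run k bs \<longleftrightarrow>
      suffix (replicate k False) bs \<or> has_failure_run k (butlast bs)"
    using sublist_snoc[of "replicate k False" "butlast bs" "last bs"] by simp
  with L obtain cs where bs: "bs = cs @ replicate k False" by (auto simp: suffix_def)
  have ne: "cs \<noteq> []" using assms bs by auto
  obtain j where k: "k = Suc j" using assms by (cases k) auto
  have bl: "butlast bs = cs @ replicate j False"
    by (simp add: bs k butlast_append replicate_Suc_snoc del: replicate.simps)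
  have "last cs"
  proof (rule ccontr)
    assume "\<not> last cs"
    then have "cs = butlast cs @ [False]" using ne by (metis append_butlast_last_id)
    then have "butlast bs = butlast cs @ replicate k False"
      using bl k by (metis append.assoc append_Cons append_Nil replicate_Suc)
    then have "has_failure_run k (butlast bs)" by (metis sublist_appendI append_Nil2)
    with L show False by simp
  qed
  moreover have "\<not> has_failure_run k cs"
    using L bl by (metis sublist_append)
  ultimately show "\<exists>cs. bs = cs @ replicate k False \<and> cs \<noteq> [] \<and> last cs \<and> \<not> has_failure_run k cs"
    using bs ne by blast
next
  assume "\<exists>cs. bs = cs @ replicate k False \<and> cs \<noteq> [] \<and> last cs \<and> \<not> has_failure_run k cs"
  then obtain cs where bs: "bs = cs @ replicate k False" and ne: "cs \<noteq> []" "last cs"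
    and no: "\<not> has_failure_run k cs" by blast
  obtain j where k: "k = Suc j" using assms by (cases k) auto
  have bl: "butlast bs = cs @ replicate j False"
    by (simp add: bs k butlast_append replicate_Suc_snoc del: replicate.simps)
  have cs: "cs = butlast cs @ [True]" using ne by (metis append_butlast_last_id)
  have "\<not> has_failure_run k (butlast cs)" using no cs by (metis sublist_append)
  moreover have "\<not> has_failure_run k (replicate j False)"
    unfolding has_failure_run_replicate using k by simp
  moreover have "butlast bs = butlast cs @ True # replicate j False" using bl cs
    by (metis append.assoc append_Cons append_Nil)
  ultimately have "\<not> has_failure_run k (butlast bs)"
    using has_failure_run_append_success[OF assms(1)] by simp
  moreover have "has_failure_run k bs" unfolding bs by (metis sublist_appendI append_Nil2)
  ultimately show "has_failure_run k bs \<and> \<not> has_failure_run k (butlast bs)" by simp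
qed

section \<open>Decomposition of words into runs\<close>

fun word_of_runs :: "nat list \<Rightarrow> nat list \<Rightarrow> bool list" where
  "word_of_runs (x # xs) (y # ys) = replicate y False @ replicate x True @ word_of_runs xs ys"
| "word_of_runs _ _ = []"

text \<open>
  A word that starts with a success is given a leading failure run of length zero. So the first
  entry of \<open>ys\<close> may vanish, while all other runs are nonempty.
\<close>

definition run_lengths :: "nat \<Rightarrow> nat \<Rightarrow> (nat list \<times> nat list) set" where
  "run_lengths m r = {(xs, ys). length xs = length ys \<and> xs \<noteq> [] \<and> (\<forall>x\<in>set xs. 0 < x) \<and>
     (\<forall>y\<in>set (tl ys). 0 < y) \<and> sum_list xs = m \<and> sum_list ys = r}"

definition words_ending_in_success :: "nat \<Rightarrow> nat \<Rightarrow> bool list set" where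
  "words_ending_in_success m r =
     {bs. bs \<noteq> [] \<and> last bs \<and> count_list bs True = m \<and> count_list bs False = r}"

lemma finite_words_ending_in_success: "finite (words_ending_in_success m r)"
proof (rule finite_subset)
  show "words_ending_in_success m r \<subseteq> {bs. set bs \<subseteq> UNIV \<and> length bs = m + r}"
    using count_True_plus_count_False by (auto simp: words_ending_in_success_def)
qed (rule finite_lists_length_eq, simp)

lemma count_word_of_runs:
  assumes "length xs = length ys"
  shows "count_list (word_of_runs xs ys) True = sum_list xs"
    and "count_list (word_of_runs xs ys) False = sum_list ys"
  using assms by (induction xs ys rule: list_induct2) (auto simp: count_list_replicate)

text \<open>
  Each of the \<open>xs ! j\<close> successes of a run is preceded by precisely the failures of the first
  \<open>j + 1\<close> failure runs.
\<close>

lemma failure_success_pairs_word_of_runs: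
  assumes "length xs = length ys"
  shows "failure_success_pairs (word_of_runs xs ys) =
    (\<Sum>j<length xs. sum_list (take (Suc j) ys) * xs ! j)"
  using assms
proof (induction xs ys rule: list_induct2)
  case (Cons x xs y ys)
  have "(\<Sum>j<length (x # xs). sum_list (take (Suc j) (y # ys)) * (x # xs) ! j) =
      y * x + (\<Sum>j<length xs. (y + sum_list (take (Suc j) ys)) * xs ! j)"
    by (simp add: sum.lessThan_Suc_shift del: sum.lessThan_Suc)
  also have "\<dots> = y * (x + sum_list xs) + (\<Sum>j<length xs. sum_list (take (Suc j) ys) * xs ! j)"
    by (simp add: algebra_simps sum.distrib sum_distrib_left sum_list_sum_nth atLeast0LessThan)
  finally show ?case using Cons
    by (simp add: failure_success_pairs_append count_list_replicate count_word_of_runs algebra_simps)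
qed simp

lemma has_failure_run_word_of_runs:
  assumes "length xs = length ys" "\<forall>x\<in>set xs. 0 < x" "k \<ge> 1"
  shows "has_failure_run k (word_of_runs xs ys) \<longleftrightarrow> (\<exists>y\<in>set ys. k \<le> y)"
  using assms
proof (induction xs ys rule: list_induct2)
  case (Cons x xs y ys)
  have drop: "has_failure_run k (replicate i True @ bs) \<longleftrightarrow> has_failure_run k bs" for i bs
    using has_failure_run_append_success[OF \<open>k \<ge> 1\<close>, of "[]"] \<open>k \<ge> 1\<close> by (induction i) auto
  obtain i where "x = Suc i" using Cons.prems by (cases x) auto
  then show ?case
    using Cons has_failure_run_append_success[OF \<open>k \<ge> 1\<close>] by (auto simp: drop has_failure_run_replicate)
qed auto

lemma word_of_runs_ending:
  assumes "length xs = length ys" "xs \<noteq> []" "\<forall>x\<in>set xs. 0 < x"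
  shows "word_of_runs xs ys \<noteq> [] \<and> last (word_of_runs xs ys)"
  using assms
proof (induction xs ys rule: list_induct2)
  case (Cons x xs y ys)
  then show ?case by (cases "xs = []") auto
qed simp

text \<open>
  Reading the word from the right, a new first letter lengthens the first run, or opens a new one:
  a success in front of a nonempty failure run becomes a success run of length one, preceded by
  an empty failure run.
\<close>

lemma word_of_runs_surj:
  assumes "bs \<noteq> []" "last bs"
  shows "\<exists>xs ys. length xs = length ys \<and> xs \<noteq> [] \<and> (\<forall>x\<in>set xs. 0 < x) \<and>
     (\<forall>y\<in>set (tl ys). 0 < y) \<and> bs = word_of_runs xs ys"
  using assms
proof (induction bs)
  case (Cons b bs)
  show ?case
  proof (cases "bs = []")
    case True
    then show ?thesis using Cons.prems by (intro exI[of _ "[1]"] exI[of _ "[0]"]) auto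
  next
    case False
    then obtain xs' ys' where *: "length xs' = length ys'" "xs' \<noteq> []" "\<forall>x\<in>set xs'. 0 < x"
      "\<forall>y\<in>set (tl ys'). 0 < y" "bs = word_of_runs xs' ys'"
      using Cons by auto
    obtain x xs where xs': "xs' = x # xs" using *(2) by (cases xs') auto
    obtain y ys where ys': "ys' = y # ys" using *(1,2) by (cases ys') auto
    consider "\<not> b" | "b" "y = 0" | "b" "y > 0" by auto
    then show ?thesis
    proof cases
      case 1
      then show ?thesis using * xs' ys' by (intro exI[of _ "x # xs"] exI[of _ "Suc y # ys"]) auto
    next
      case 2
      then show ?thesis using * xs' ys' by (intro exI[of _ "Suc x # xs"] exI[of _ "0 # ys"]) auto
    next
      case 3
      then show ?thesis using * xs' ys'
        by (intro exI[of _ "1 # x # xs"] exI[of _ "0 # y # ys"]) auto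
    qed
  qed
qed simp

lemma replicate_append_eq_replicate_append:
  assumes "replicate i a @ as = replicate j a @ bs"
    and "as = [] \<or> hd as \<noteq> a" "bs = [] \<or> hd bs \<noteq> a"
  shows "i = j \<and> as = bs"
  using assms(1)
proof (induction i arbitrary: j)
  case 0
  then show ?case using assms(2) by (cases j) auto
next
  case (Suc i)
  then show ?case using assms(3) by (cases j) auto
qed

lemma in_set_tlD: "x \<in> set (tl xs) \<Longrightarrow> x \<in> set xs"
  by (cases xs) auto

text \<open>
  The runs can be read off the word from the left: since all runs but the first failure run are
  nonempty, every run is followed by a different letter or by the end of the word.
\<close>

lemma word_of_runs_inj:
  assumes "length xs = length ys" "length xs' = length ys'"
    and "\<forall>x\<in>set xs. 0 < x" "\<forall>x\<in>set xs'. 0 < x"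
    and "\<forall>y\<in>set (tl ys). 0 < y" "\<forall>y\<in>set (tl ys'). 0 < y"
    and "word_of_runs xs ys = word_of_runs xs' ys'"
  shows "xs = xs' \<and> ys = ys'"
  using assms
proof (induction xs ys arbitrary: xs' ys' rule: list_induct2)
  case Nil
  then show ?case using word_of_runs_ending[of xs' ys'] by fastforce
next
  case (Cons x xs y ys)
  have "xs' \<noteq> []" using Cons.prems word_of_runs_ending[of "x # xs" "y # ys"] Cons.hyps by auto
  then obtain x' zs where xs': "xs' = x' # zs" by (cases xs') auto
  obtain y' ws where ys': "ys' = y' # ws" using Cons.prems(1) xs' by (cases ys') auto
  have tail: "word_of_runs us vs = [] \<or> hd (word_of_runs us vs) \<noteq> True"
    if "\<forall>v\<in>set vs. 0 < v" for us vs
    using that by (cases "(us, vs)" rule: word_of_runs.cases) (auto simp: hd_append)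
  have pos: "0 < x" "0 < x'" using Cons.prems xs' by auto
  have "y = y' \<and> replicate x True @ word_of_runs xs ys = replicate x' True @ word_of_runs zs ws"
    by (rule replicate_append_eq_replicate_append[of _ False])
      (use Cons.prems xs' ys' pos in \<open>auto simp: hd_append\<close>)
  moreover from this have "x = x' \<and> word_of_runs xs ys = word_of_runs zs ws"
    by (intro replicate_append_eq_replicate_append[of _ True])
      (use Cons.prems xs' ys' tail in auto)
  moreover from this have "xs = zs \<and> ys = ws"
    using Cons.prems xs' ys' by (intro Cons.IH) (auto dest: in_set_tlD)
  ultimately show ?case using xs' ys' by simp
qed

lemma bij_betw_word_of_runs:
  "bij_betw (\<lambda>(xs, ys). word_of_runs xs ys) (run_lengths m r) (words_ending_in_success m r)"
  unfolding bij_betw_def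
proof
  show "inj_on (\<lambda>(xs, ys). word_of_runs xs ys) (run_lengths m r)"
  proof (rule inj_onI, clarify)
    fix xs ys xs' ys'
    assume "(xs, ys) \<in> run_lengths m r" "(xs', ys') \<in> run_lengths m r"
      "word_of_runs xs ys = word_of_runs xs' ys'"
    then show "xs = xs' \<and> ys = ys'"
      by (intro word_of_runs_inj) (simp_all add: run_lengths_def)
  qed
  show "(\<lambda>(xs, ys). word_of_runs xs ys) ` run_lengths m r = words_ending_in_success m r"
  proof (intro equalityI subsetI)
    fix bs assume "bs \<in> (\<lambda>(xs, ys). word_of_runs xs ys) ` run_lengths m r"
    then show "bs \<in> words_ending_in_success m r"
      using word_of_runs_ending
      by (auto simp: run_lengths_def words_ending_in_success_def count_word_of_runs)
  next
    fix bs assume bs: "bs \<in> words_ending_in_success m r"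
    then obtain xs ys where *: "length xs = length ys" "xs \<noteq> []" "\<forall>x\<in>set xs. 0 < x"
      "\<forall>y\<in>set (tl ys). 0 < y" "bs = word_of_runs xs ys"
      using word_of_runs_surj[of bs] by (auto simp: words_ending_in_success_def)
    then have "(xs, ys) \<in> run_lengths m r"
      using bs count_word_of_runs[OF *(1)] by (auto simp: run_lengths_def words_ending_in_success_def)
    then show "bs \<in> (\<lambda>(xs, ys). word_of_runs xs ys) ` run_lengths m r"
      using *(5) by force
  qed
qed

lemma S_tuples_0_iff:
  "xs \<in> S_tuples 0 r s \<longleftrightarrow> length xs = s \<and> (\<forall>x\<in>set xs. 0 < x) \<and> sum_list xs = r"
proof -
  have "0 < Max (set xs)" if "xs \<noteq> []" "\<forall>x\<in>set xs. 0 < x"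
    using that Max_in[of "set xs"] by simp
  then show ?thesis by (auto simp: S_tuples_def)
qed

lemma length_le_sum_list:
  fixes xs :: "nat list"
  shows "\<forall>x\<in>set xs. 0 < x \<Longrightarrow> length xs \<le> sum_list xs"
  by (induction xs) auto

lemma run_lengths_of_length:
  assumes "s \<ge> 1"
  shows "{p \<in> run_lengths m r. length (fst p) = s} =
    (\<lambda>(xs, ys). (xs, 0 # ys)) ` (S_tuples 0 m s \<times> S_tuples 0 r (s - 1))
      \<union> S_tuples 0 m s \<times> S_tuples 0 r s" (is "?L = ?A \<union> ?B")
proof (intro equalityI subsetI)
  fix p assume "p \<in> ?L"
  then obtain xs y ys where p: "p = (xs, y # ys)" and *: "length xs = Suc (length ys)"
    "\<forall>x\<in>set xs. 0 < x" "\<forall>y\<in>set ys. 0 < y" "sum_list xs = m" "y + sum_list ys = r" "length xs = s"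
    by (cases p; cases "snd p") (auto simp: run_lengths_def)
  show "p \<in> ?A \<union> ?B"
  proof (cases "y = 0")
    case True
    then have "(xs, ys) \<in> S_tuples 0 m s \<times> S_tuples 0 r (s - 1)"
      using * by (auto simp: S_tuples_0_iff)
    then show ?thesis using True p by force
  next
    case False
    then show ?thesis using p * by (auto simp: S_tuples_0_iff)
  qed
next
  fix p assume "p \<in> ?A \<union> ?B"
  then show "p \<in> ?L"
    using assms by (auto simp: run_lengths_def S_tuples_0_iff dest: in_set_tlD)
qed

text \<open>
  The index \<open>s\<close> is the number of success runs, which is at most \<open>m\<close> because each of them
  contains a success. For each \<open>s\<close> the two inner sums separate the words by their first letter.
\<close>

lemma sum_words_ending_in_success:
  fixes f :: "bool list \<Rightarrow> real"
  shows "(\<Sum>bs\<in>words_ending_in_success m r. f bs) =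
    (\<Sum>s=1..m. (\<Sum>(xs, ys)\<in>S_tuples 0 m s \<times> S_tuples 0 r (s - 1). f (word_of_runs xs (0 # ys)))
      + (\<Sum>(xs, ys)\<in>S_tuples 0 m s \<times> S_tuples 0 r s. f (word_of_runs xs ys)))"
proof -
  let ?g = "\<lambda>(xs, ys). f (word_of_runs xs ys)"
  have fin: "finite (run_lengths m r)"
    using bij_betw_finite[OF bij_betw_word_of_runs] finite_words_ending_in_success by blast
  have "(\<Sum>bs\<in>words_ending_in_success m r. f bs) = (\<Sum>p\<in>run_lengths m r. ?g p)"
    using sum.reindex_bij_betw[OF bij_betw_word_of_runs, of f m r] by (simp add: case_prod_unfold)
  also have "\<dots> = (\<Sum>s=1..m. \<Sum>p\<in>{p \<in> run_lengths m r. length (fst p) = s}. ?g p)"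
  proof (rule sum.group[symmetric, OF fin])
    show "(\<lambda>p. length (fst p)) ` run_lengths m r \<subseteq> {1..m}"
      using length_le_sum_list by (fastforce simp: run_lengths_def Suc_le_eq)
  qed simp
  also have "\<dots> = (\<Sum>s=1..m.
      (\<Sum>(xs, ys)\<in>S_tuples 0 m s \<times> S_tuples 0 r (s - 1). f (word_of_runs xs (0 # ys)))
      + (\<Sum>(xs, ys)\<in>S_tuples 0 m s \<times> S_tuples 0 r s. f (word_of_runs xs ys)))"
  proof (rule sum.cong[OF refl])
    fix s assume "s \<in> {1..m}"
    then have s: "s \<ge> 1" by simp
    let ?h = "\<lambda>(xs, ys). (xs :: nat list, 0 # ys :: nat list)"
    have inj: "inj_on ?h (S_tuples 0 m s \<times> S_tuples 0 r (s - 1))" by (auto simp: inj_on_def)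
    have "(\<Sum>p\<in>{p \<in> run_lengths m r. length (fst p) = s}. ?g p) =
        (\<Sum>p\<in>?h ` (S_tuples 0 m s \<times> S_tuples 0 r (s - 1)). ?g p)
        + (\<Sum>p\<in>S_tuples 0 m s \<times> S_tuples 0 r s. ?g p)"
      unfolding run_lengths_of_length[OF s]
      by (rule sum.union_disjoint) (auto simp: finite_S_tuples S_tuples_0_iff)
    then show "(\<Sum>p\<in>{p \<in> run_lengths m r. length (fst p) = s}. ?g p) =
      (\<Sum>(xs, ys)\<in>S_tuples 0 m s \<times> S_tuples 0 r (s - 1). f (word_of_runs xs (0 # ys)))
      + (\<Sum>(xs, ys)\<in>S_tuples 0 m s \<times> S_tuples 0 r s. f (word_of_runs xs ys))"
      by (simp only: sum.reindex[OF inj]) (simp add: case_prod_unfold comp_def)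
  qed
  finally show ?thesis .
qed

text \<open>
  For the empty tuple the condition on the maximum reads \<open>k - 1 = 0\<close>, which for \<open>k = 1\<close> does
  not provide an entry that is at least \<open>k\<close>; the hypothesis on \<open>r\<close> excludes this tuple.
\<close>

lemma S_tuples_eq_long_run:
  assumes "k \<ge> 1" "r \<ge> 1"
  shows "S_tuples (k - 1) r s = {ys \<in> S_tuples 0 r s. \<exists>y\<in>set ys. k \<le> y}"
proof (cases "s = 0")
  case True
  then show ?thesis using assms by (auto simp: S_tuples_def)
next
  case False
  have "k - 1 < Max (set ys) \<longleftrightarrow> (\<exists>y\<in>set ys. k \<le> y)" if "length ys = s" for ys :: "nat list"
  proof -
    have "set ys \<noteq> {}" using that False by auto
    moreover have "k - 1 < y \<longleftrightarrow> k \<le> y" for y using assms(1) by linarith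
    ultimately show ?thesis by (simp add: Max_ge_iff)
  qed
  then show ?thesis using False unfolding set_eq_iff mem_Collect_eq S_tuples_0_iff
    by (auto simp: S_tuples_def)
qed

text \<open>
  The leading empty failure run shifts the indices by one and removes the summand \<open>j = 1\<close>: the
  first successes are preceded by no failure.
\<close>

lemma pairs_word_of_runs_success_first:
  assumes "xs \<in> S_tuples 0 m s" "ys \<in> S_tuples 0 r (s - 1)" "s \<ge> 1"
  shows "failure_success_pairs (word_of_runs xs (0 # ys)) =
    (\<Sum>j=2..s. sum_list (take (j - 1) ys) * xs ! (j - 1))"
proof -
  obtain t where s: "s = Suc t" using assms(3) by (cases s) auto
  have "failure_success_pairs (word_of_runs xs (0 # ys)) =
      (\<Sum>j<Suc t. sum_list (take (Suc j) (0 # ys)) * xs ! j)"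
    using assms s by (simp add: failure_success_pairs_word_of_runs S_tuples_0_iff)
  also have "\<dots> = (\<Sum>j<t. sum_list (take (Suc j) ys) * xs ! Suc j)"
    by (simp add: sum.lessThan_Suc_shift del: sum.lessThan_Suc)
  also have "\<dots> = (\<Sum>j=2..s. sum_list (take (j - 1) ys) * xs ! (j - 1))"
    by (rule sum.reindex_bij_witness[of _ "\<lambda>j. j - 2" "\<lambda>j. j + 2"]) (auto simp: s)
  finally show ?thesis .
qed

lemma pairs_word_of_runs_failure_first:
  assumes "xs \<in> S_tuples 0 m s" "ys \<in> S_tuples 0 r s"
  shows "failure_success_pairs (word_of_runs xs ys) =
    (\<Sum>j=1..s. sum_list (take j ys) * xs ! (j - 1))"
proof -
  have "failure_success_pairs (word_of_runs xs ys) =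
      (\<Sum>j<s. sum_list (take (Suc j) ys) * xs ! j)"
    using assms by (simp add: failure_success_pairs_word_of_runs S_tuples_0_iff)
  also have "\<dots> = (\<Sum>j=1..s. sum_list (take j ys) * xs ! (j - 1))"
    by (rule sum.reindex_bij_witness[of _ "\<lambda>j. j - 1" "\<lambda>j. j + 1"]) auto
  finally show ?thesis .
qed

lemma sum_Times_filter:
  assumes "finite A" "finite B"
  shows "(\<Sum>(x, y)\<in>A \<times> {y \<in> B. R y}. g x y) = (\<Sum>(x, y)\<in>A \<times> B. if R y then g x y else 0)"
proof -
  have "A \<times> {y \<in> B. R y} = {p \<in> A \<times> B. R (snd p)}" by auto
  then show ?thesis using assms by (simp add: sum.inter_filter case_prod_unfold)
qed

text \<open>
  The truth value \<open>c\<close> lets one computation serve both orders of the waiting times: the words with the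
  run (\<open>c = True\<close>) and those without it (\<open>c = False\<close>).
\<close>

lemma sum_words_by_failure_run:
  fixes q :: real
  assumes "k \<ge> 1"
  shows "(\<Sum>bs\<in>{bs \<in> words_ending_in_success m r. has_failure_run k bs = c}. q ^ failure_success_pairs bs) =
    (\<Sum>s=1..m. (\<Sum>(xs, ys)\<in>S_tuples 0 m s \<times> {ys \<in> S_tuples 0 r (s - 1). (\<exists>y\<in>set ys. k \<le> y) = c}.
        q ^ (\<Sum>j=2..s. sum_list (take (j - 1) ys) * xs ! (j - 1)))
      + (\<Sum>(xs, ys)\<in>S_tuples 0 m s \<times> {ys \<in> S_tuples 0 r s. (\<exists>y\<in>set ys. k \<le> y) = c}.
        q ^ (\<Sum>j=1..s. sum_list (take j ys) * xs ! (j - 1))))"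
proof -
  let ?f = "\<lambda>bs. if has_failure_run k bs = c then q ^ failure_success_pairs bs else 0"
  have run: "has_failure_run k (word_of_runs xs ys) \<longleftrightarrow> (\<exists>y\<in>set ys. k \<le> y)"
    if "xs \<in> S_tuples 0 m s" "length ys = s" for xs ys s
    using that by (intro has_failure_run_word_of_runs assms) (simp_all add: S_tuples_0_iff)
  have "(\<Sum>bs\<in>{bs \<in> words_ending_in_success m r. has_failure_run k bs = c}. q ^ failure_success_pairs bs) =
      (\<Sum>bs\<in>words_ending_in_success m r. ?f bs)"
    by (rule sum.inter_filter[OF finite_words_ending_in_success])
  also have "\<dots> = (\<Sum>s=1..m.
      (\<Sum>(xs, ys)\<in>S_tuples 0 m s \<times> S_tuples 0 r (s - 1). ?f (word_of_runs xs (0 # ys)))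
      + (\<Sum>(xs, ys)\<in>S_tuples 0 m s \<times> S_tuples 0 r s. ?f (word_of_runs xs ys)))"
    by (rule sum_words_ending_in_success)
  also have "\<dots> = (\<Sum>s=1..m.
      (\<Sum>(xs, ys)\<in>S_tuples 0 m s \<times> S_tuples 0 r (s - 1). if (\<exists>y\<in>set ys. k \<le> y) = c
        then q ^ (\<Sum>j=2..s. sum_list (take (j - 1) ys) * xs ! (j - 1)) else 0)
      + (\<Sum>(xs, ys)\<in>S_tuples 0 m s \<times> S_tuples 0 r s. if (\<exists>y\<in>set ys. k \<le> y) = c
        then q ^ (\<Sum>j=1..s. sum_list (take j ys) * xs ! (j - 1)) else 0))"
  proof (intro sum.cong[OF refl] arg_cong2[where f = "(+)"]; clarify)
    fix s xs ys
    assume s: "s \<in> {1..m}" and xs: "xs \<in> S_tuples 0 m s" and ys: "ys \<in> S_tuples 0 r (s - 1)"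
    have "length (0 # ys) = s" using s ys by (simp add: S_tuples_0_iff)
    from run[OF xs this] have "has_failure_run k (word_of_runs xs (0 # ys)) \<longleftrightarrow> (\<exists>y\<in>set ys. k \<le> y)"
      using assms by simp
    then show "?f (word_of_runs xs (0 # ys)) = (if (\<exists>y\<in>set ys. k \<le> y) = c
        then q ^ (\<Sum>j=2..s. sum_list (take (j - 1) ys) * xs ! (j - 1)) else 0)"
      using pairs_word_of_runs_success_first[OF xs ys] s by simp
  next
    fix s xs ys
    assume xs: "xs \<in> S_tuples 0 m s" and ys: "ys \<in> S_tuples 0 r s"
    have "length ys = s" using ys by (simp add: S_tuples_0_iff)
    from run[OF xs this] show "?f (word_of_runs xs ys) = (if (\<exists>y\<in>set ys. k \<le> y) = c
        then q ^ (\<Sum>j=1..s. sum_list (take j ys) * xs ! (j - 1)) else 0)"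
      using pairs_word_of_runs_failure_first[OF xs ys] by simp
  qed
  finally show ?thesis
    by (simp only: sum_Times_filter[OF finite_S_tuples finite_S_tuples])
qed

lemma sum_words_with_failure_run:
  assumes "k \<ge> 1" "r \<ge> 1"
  shows "(\<Sum>bs\<in>{bs \<in> words_ending_in_success m r. has_failure_run k bs}. q ^ failure_success_pairs bs) =
    (\<Sum>s=1..m. I_sum q k m r s + J_sum q k m r s)"
  using sum_words_by_failure_run[OF assms(1), where m = m and r = r and c = True and q = q]
  by (simp only: I_sum_def J_sum_def S_tuples_eq_long_run[OF assms] simp_thms)

lemma sum_words_without_failure_run:
  assumes "k \<ge> 1"
  shows "(\<Sum>bs\<in>{bs \<in> words_ending_in_success m r. \<not> has_failure_run k bs}. q ^ failure_success_pairs bs) =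
    (\<Sum>s=1..m. G_bar q k m r s + H_bar q k m r s)"
proof -
  have "(\<forall>y\<in>set ys. y < k) \<longleftrightarrow> ((\<exists>y\<in>set ys. k \<le> y) = False)" for ys by (auto simp: not_le)
  moreover have "{bs \<in> words_ending_in_success m r. \<not> has_failure_run k bs} =
      {bs \<in> words_ending_in_success m r. has_failure_run k bs = False}" by simp
  ultimately show ?thesis
    by (simp only: G_bar_def H_bar_def sum_words_by_failure_run[OF assms])
qed

section \<open>The distribution of the waiting time\<close>

lemma quota_last_iff:
  assumes "\<forall>j\<ge>1. X j \<omega> \<in> {0, 1}" "k1 \<ge> 1" "k2 \<ge> 1" "n \<ge> 1"
  shows "success_quota_time k1 X \<omega> = enat n \<and> failure_run_time k2 X \<omega> < enat n \<longleftrightarrow>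
    outcomes X n \<omega> \<in> {bs \<in> words_ending_in_success k1 (n - k1). has_failure_run k2 bs}"
proof -
  obtain m where n: "n = Suc m" using assms(4) by (cases n) auto
  then show ?thesis
    using count_True_plus_count_False[of "outcomes X n \<omega>"]
    unfolding n success_quota_time_eq_iff[OF assms(2)] failure_run_time_less_iff[where X = X and \<omega> = \<omega>, OF assms(1)]
    by (auto simp: words_ending_in_success_def outcomes_Suc has_failure_run_snoc_success[OF assms(3)])
qed

text \<open>
  The final failures contain no success, so the successes before trial \<open>n\<close> are those of the part
  \<open>cs\<close> in front of the run, and their number \<open>i\<close> ranges from the quota upwards. Since \<open>k1 \<ge> 1\<close>,
  this part contains a success and the final run is the whole of the last failure run.
\<close>

lemma run_last_iff:
  assumes "\<forall>j\<ge>1. X j \<omega> \<in> {0, 1}" "k1 \<ge> 1" "k2 \<ge> 1" "n \<ge> 1"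
  shows "failure_run_time k2 X \<omega> = enat n \<and> success_quota_time k1 X \<omega> < enat n \<longleftrightarrow>
    outcomes X n \<omega> \<in> (\<lambda>cs. cs @ replicate k2 False) `
      (\<Union>i\<in>{k1..n - k2}. {cs \<in> words_ending_in_success i (n - k2 - i). \<not> has_failure_run k2 cs})"
    (is "?L \<longleftrightarrow> ?R")
proof -
  obtain m where n: "n = Suc m" using assms(4) by (cases n) auto
  let ?bs = "outcomes X n \<omega>"
  have bl: "outcomes X m \<omega> = butlast ?bs" by (simp add: n outcomes_Suc)
  have L: "?L \<longleftrightarrow> has_failure_run k2 ?bs \<and> \<not> has_failure_run k2 (butlast ?bs) \<and>
      k1 \<le> count_list (butlast ?bs) True"
    unfolding n failure_run_time_eq_iff[where X = X and \<omega> = \<omega>, OF assms(1)] success_quota_time_less_iff[OF assms(2)]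
    by (simp only: bl[unfolded n] conj_assoc)
  have len: "length ?bs = n" by simp
  have "(has_failure_run k2 bs \<and> \<not> has_failure_run k2 (butlast bs) \<and> k1 \<le> count_list (butlast bs) True)
     \<longleftrightarrow> bs \<in> (\<lambda>cs. cs @ replicate k2 False) `
      (\<Union>i\<in>{k1..n - k2}. {cs \<in> words_ending_in_success i (n - k2 - i). \<not> has_failure_run k2 cs})"
    if len: "length bs = n" for bs
  proof
    assume *: "has_failure_run k2 bs \<and> \<not> has_failure_run k2 (butlast bs) \<and> k1 \<le> count_list (butlast bs) True"
    have "True \<in> set (butlast bs)"
      using * assms(2) count_list_0_iff[of "butlast bs" True] by fastforce
    then have "\<exists>b\<in>set bs. b" by (auto dest: in_set_butlastD)
    with * obtain cs where cs: "bs = cs @ replicate k2 False" "cs \<noteq> []" "last cs" "\<not> has_failure_run k2 cs"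
      using first_failure_run_at_end_iff[OF assms(3), of bs] by blast
    have "count_list (butlast bs) True \<le> count_list bs True"
      using len n by (cases bs rule: rev_cases) auto
    also have "\<dots> = count_list cs True" by (simp add: cs(1) count_list_replicate)
    finally have "k1 \<le> count_list cs True" using * by simp
    moreover have "count_list cs True + count_list cs False = n - k2"
      using count_True_plus_count_False[of cs] len cs(1) by simp
    ultimately have "cs \<in> (\<Union>i\<in>{k1..n - k2}. {cs \<in> words_ending_in_success i (n - k2 - i). \<not> has_failure_run k2 cs})"
      using cs by (auto simp: words_ending_in_success_def)
    then show "bs \<in> (\<lambda>cs. cs @ replicate k2 False) `
      (\<Union>i\<in>{k1..n - k2}. {cs \<in> words_ending_in_success i (n - k2 - i). \<not> has_failure_run k2 cs})"
      using cs(1) by blast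
  next
    assume "bs \<in> (\<lambda>cs. cs @ replicate k2 False) `
      (\<Union>i\<in>{k1..n - k2}. {cs \<in> words_ending_in_success i (n - k2 - i). \<not> has_failure_run k2 cs})"
    then obtain cs where cs: "bs = cs @ replicate k2 False" "cs \<noteq> []" "last cs" "\<not> has_failure_run k2 cs"
      "k1 \<le> count_list cs True"
      by (auto simp: words_ending_in_success_def)
    have "\<exists>b\<in>set bs. b" using cs(1-3) last_in_set[of cs] by auto
    then have "has_failure_run k2 bs \<and> \<not> has_failure_run k2 (butlast bs)"
      using first_failure_run_at_end_iff[OF assms(3), of bs] cs by blast
    moreover obtain j where "k2 = Suc j" using assms(3) by (cases k2) auto
    then have "count_list (butlast bs) True = count_list cs True"
      by (simp add: cs(1) replicate_Suc_snoc butlast_append count_list_replicate del: replicate.simps)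
    ultimately show "has_failure_run k2 bs \<and> \<not> has_failure_run k2 (butlast bs) \<and> k1 \<le> count_list (butlast bs) True"
      using cs(5) by simp
  qed
  from this[OF len] show ?thesis unfolding L .
qed

text \<open>
  A trial that completes the quota is a success, and appending a success to a word completes no
  run of failures.
\<close>

lemma not_both_at_same_trial:
  assumes "\<forall>j\<ge>1. X j \<omega> \<in> {0, 1}" "k1 \<ge> 1" "k2 \<ge> 1" "n \<ge> 1"
  shows "\<not> (success_quota_time k1 X \<omega> = enat n \<and> failure_run_time k2 X \<omega> = enat n)"
proof -
  obtain m where n: "n = Suc m" using assms(4) by (cases n) auto
  then show ?thesis
    unfolding n success_quota_time_eq_iff[OF assms(2)] failure_run_time_eq_iff[where X = X and \<omega> = \<omega>, OF assms(1)]
    by (auto simp: outcomes_Suc has_failure_run_snoc_success[OF assms(3)])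
qed

lemma word_weight_append_failures:
  "word_weight q \<theta> (cs @ replicate k False) =
     \<theta> ^ count_list cs True * (\<Prod>j=1..count_list cs False + k. 1 - \<theta> * q ^ (j - 1))
       * q ^ failure_success_pairs cs"
  by (simp add: word_weight_def failure_success_pairs_append count_list_replicate)

theorem theorem4p2:
  fixes q \<theta> :: real and M :: "'a measure" and X :: "nat \<Rightarrow> 'a \<Rightarrow> nat"
    and k1 k2 n :: nat
  assumes "0 \<le> \<theta>" "\<theta> \<le> 1" "0 < q" "q < 1"
    and "q_trials q \<theta> M X"
    and "k1 \<ge> 1" "k2 \<ge> 1" "n \<ge> k1 + k2"
  shows "\<P>(\<omega> in M. W_L k1 k2 X \<omega> = enat n) = P1_L M X k1 k2 n + P0_L M X k1 k2 n
    \<and> P1_L M X k1 k2 n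
        = \<theta> ^ k1 * (\<Prod>j=1..n - k1. 1 - \<theta> * q ^ (j - 1)) *
          (\<Sum>s=1..k1. I_sum q k2 k1 (n - k1) s + J_sum q k2 k1 (n - k1) s)
    \<and> P0_L M X k1 k2 n
        = (\<Sum>i=k1..n - k2. \<theta> ^ i * (\<Prod>j=1..n - i. 1 - \<theta> * q ^ (j - 1)) *
          (\<Sum>s=1..i. G_bar q k2 i (n - k2 - i) s + H_bar q k2 i (n - k2 - i) s))"
proof (intro conjI)
  note trials = assms(5)
  interpret prob_space M using trials by (simp add: q_trials_def)
  note [measurable] = measurable_outcomes[OF trials]
  have binary: "\<forall>j\<ge>1. X j \<omega> \<in> {0, 1}" if "\<omega> \<in> space M" for \<omega>
    using trials that unfolding q_trials_def by blast
  have n: "n \<ge> 1" using assms by simp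
  let ?B1 = "{bs \<in> words_ending_in_success k1 (n - k1). has_failure_run k2 bs}"
  let ?C = "\<lambda>i. {cs \<in> words_ending_in_success i (n - k2 - i). \<not> has_failure_run k2 cs}"
  let ?B0 = "(\<lambda>cs. cs @ replicate k2 False) ` (\<Union>i\<in>{k1..n - k2}. ?C i)"
  have E1: "success_quota_time k1 X \<omega> = enat n \<and> failure_run_time k2 X \<omega> < enat n \<longleftrightarrow>
      outcomes X n \<omega> \<in> ?B1" if "\<omega> \<in> space M" for \<omega>
    by (rule quota_last_iff[where X = X and \<omega> = \<omega>, OF binary[OF that] assms(6,7) n])
  have E0: "failure_run_time k2 X \<omega> = enat n \<and> success_quota_time k1 X \<omega> < enat n \<longleftrightarrow>
      outcomes X n \<omega> \<in> ?B0" if "\<omega> \<in> space M" for \<omega>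
    by (rule run_last_iff[where X = X and \<omega> = \<omega>, OF binary[OF that] assms(6,7) n])
  have P1: "P1_L M X k1 k2 n = \<P>(\<omega> in M. outcomes X n \<omega> \<in> ?B1)"
    unfolding P1_L_def by (intro arg_cong[where f = "measure M"] Collect_cong conj_cong refl) (rule E1)
  have P0: "P0_L M X k1 k2 n = \<P>(\<omega> in M. outcomes X n \<omega> \<in> ?B0)"
    unfolding P0_L_def by (intro arg_cong[where f = "measure M"] Collect_cong conj_cong refl) (rule E0)

  have W: "W_L k1 k2 X \<omega> = enat n \<longleftrightarrow> outcomes X n \<omega> \<in> ?B1 \<or> outcomes X n \<omega> \<in> ?B0"
    if "\<omega> \<in> space M" for \<omega>
    unfolding E1[OF that, symmetric] E0[OF that, symmetric] W_L_def
    using not_both_at_same_trial[where X = X and \<omega> = \<omega>, OF binary[OF that] assms(6,7) n] by (auto simp: max_def)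
  have "{\<omega>\<in>space M. W_L k1 k2 X \<omega> = enat n} =
      {\<omega>\<in>space M. outcomes X n \<omega> \<in> ?B1} \<union> {\<omega>\<in>space M. outcomes X n \<omega> \<in> ?B0}"
    using W by blast
  moreover have "{\<omega>\<in>space M. outcomes X n \<omega> \<in> ?B1} \<inter> {\<omega>\<in>space M. outcomes X n \<omega> \<in> ?B0} = {}"
  proof (rule equals0I)
    fix \<omega>
    assume "\<omega> \<in> {\<omega>\<in>space M. outcomes X n \<omega> \<in> ?B1} \<inter> {\<omega>\<in>space M. outcomes X n \<omega> \<in> ?B0}"
    then have \<omega>: "\<omega> \<in> space M" "outcomes X n \<omega> \<in> ?B1" "outcomes X n \<omega> \<in> ?B0" by blast+
    have "success_quota_time k1 X \<omega> = enat n" using E1[OF \<omega>(1)] \<omega>(2) by blast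
    moreover have "success_quota_time k1 X \<omega> < enat n" using E0[OF \<omega>(1)] \<omega>(3) by blast
    ultimately show False by simp
  qed
  moreover have "{\<omega>\<in>space M. outcomes X n \<omega> \<in> B} \<in> events" for B
    by measurable
  ultimately show "\<P>(\<omega> in M. W_L k1 k2 X \<omega> = enat n) = P1_L M X k1 k2 n + P0_L M X k1 k2 n"
    unfolding P1 P0 by (simp only: finite_measure_Union)

  have "P1_L M X k1 k2 n = (\<Sum>bs\<in>?B1. word_weight q \<theta> bs)"
    unfolding P1
  proof (rule prob_outcomes_mem[OF trials])
    show "?B1 \<subseteq> {bs. length bs = n}"
      using assms(8) by (auto simp: words_ending_in_success_def count_True_plus_count_False[symmetric])
  qed
  also have "\<dots> = (\<Sum>bs\<in>?B1. \<theta> ^ k1 * (\<Prod>j=1..n - k1. 1 - \<theta> * q ^ (j - 1)) * q ^ failure_success_pairs bs)"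
    by (rule sum.cong) (auto simp: word_weight_def words_ending_in_success_def)
  also have "\<dots> = \<theta> ^ k1 * (\<Prod>j=1..n - k1. 1 - \<theta> * q ^ (j - 1)) *
      (\<Sum>s=1..k1. I_sum q k2 k1 (n - k1) s + J_sum q k2 k1 (n - k1) s)"
    using assms(7,8) by (simp only: sum_distrib_left[symmetric]) (subst sum_words_with_failure_run, auto)
  finally show "P1_L M X k1 k2 n = \<theta> ^ k1 * (\<Prod>j=1..n - k1. 1 - \<theta> * q ^ (j - 1)) *
      (\<Sum>s=1..k1. I_sum q k2 k1 (n - k1) s + J_sum q k2 k1 (n - k1) s)" .

  have "P0_L M X k1 k2 n = (\<Sum>bs\<in>?B0. word_weight q \<theta> bs)"
    unfolding P0
  proof (rule prob_outcomes_mem[OF trials])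
    show "?B0 \<subseteq> {bs. length bs = n}"
      using assms(8) by (auto simp: words_ending_in_success_def count_True_plus_count_False[symmetric]
          count_list_replicate)
  qed
  also have "\<dots> = (\<Sum>cs\<in>(\<Union>i\<in>{k1..n - k2}. ?C i). word_weight q \<theta> (cs @ replicate k2 False))"
    by (subst sum.reindex) (auto simp: inj_on_def)
  also have "\<dots> = (\<Sum>i=k1..n - k2. \<Sum>cs\<in>?C i. word_weight q \<theta> (cs @ replicate k2 False))"
    by (rule sum.UNION_disjoint)
      (simp_all add: finite_words_ending_in_success, auto simp: words_ending_in_success_def)
  also have "\<dots> = (\<Sum>i=k1..n - k2. \<theta> ^ i * (\<Prod>j=1..n - i. 1 - \<theta> * q ^ (j - 1)) *
      (\<Sum>s=1..i. G_bar q k2 i (n - k2 - i) s + H_bar q k2 i (n - k2 - i) s))"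
  proof (rule sum.cong[OF refl])
    fix i assume "i \<in> {k1..n - k2}"
    then have i: "n - k2 - i + k2 = n - i" using assms(8) by auto
    have "(\<Sum>cs\<in>?C i. word_weight q \<theta> (cs @ replicate k2 False)) =
       (\<Sum>cs\<in>?C i. \<theta> ^ i * (\<Prod>j=1..n - i. 1 - \<theta> * q ^ (j - 1)) * q ^ failure_success_pairs cs)"
    proof (rule sum.cong[OF refl])
      fix cs assume "cs \<in> ?C i"
      then have "count_list cs True = i" "count_list cs False = n - k2 - i"
        by (auto simp: words_ending_in_success_def)
      then show "word_weight q \<theta> (cs @ replicate k2 False) =
          \<theta> ^ i * (\<Prod>j=1..n - i. 1 - \<theta> * q ^ (j - 1)) * q ^ failure_success_pairs cs"
        by (simp only: word_weight_append_failures i)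
    qed
    also have "\<dots> = \<theta> ^ i * (\<Prod>j=1..n - i. 1 - \<theta> * q ^ (j - 1)) *
      (\<Sum>s=1..i. G_bar q k2 i (n - k2 - i) s + H_bar q k2 i (n - k2 - i) s)"
      by (simp only: sum_distrib_left[symmetric] sum_words_without_failure_run[OF assms(7)])
    finally show "(\<Sum>cs\<in>?C i. word_weight q \<theta> (cs @ replicate k2 False)) =
      \<theta> ^ i * (\<Prod>j=1..n - i. 1 - \<theta> * q ^ (j - 1)) *
      (\<Sum>s=1..i. G_bar q k2 i (n - k2 - i) s + H_bar q k2 i (n - k2 - i) s)" .
  qed
  finally show "P0_L M X k1 k2 n = (\<Sum>i=k1..n - k2. \<theta> ^ i * (\<Prod>j=1..n - i. 1 - \<theta> * q ^ (j - 1)) *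
      (\<Sum>s=1..i. G_bar q k2 i (n - k2 - i) s + H_bar q k2 i (n - k2 - i) s))" .
qed

end
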